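(* Let $\mathcal A$ be a bicomplex algebra equipped with a $\mathbb D$-valued norm $\|\cdot\|_{\mathbb D}$ and an involution $x\mapsto x^*$, and let $\mathcal A=e_1\mathcal A_1+e_2\mathcal A_2$ be its idempotent decomposition, where $\mathcal A_l=e_l\mathcal A$ ($l=1,2$) carries the induced complex algebra structure, norm $\|\cdot\|_l$ and involution. Then $\mathcal A$ is a $\mathbb D$-normed bicomplex $C^*$-algebra if and only if $\mathcal A_1$ and $\mathcal A_2$ are complex $C^*$-algebras.
   Context: Bicomplex numbers: $\mathbb{BC}=\{z+jw : z,w\in\mathbb C(i)\}$, a commutative ring with $i^2=j^2=-1$, $ij=ji$; $\mathbb C(i)$ is the complex field with imaginary unit $i$. Put $e_1=\frac{1+ij}{2}$, $e_2=\frac{1-ij}{2}$; these are idempotents with $e_1e_2=0$, $e_1+e_2=1$, and every $Z=z+jw$ is uniquely $Z=e_1z_1+e_2z_2$ with $z_1=z-iw$, $z_2=z+iw\in\mathbb C(i)$. The conjugation $\dagger_3$ is $Z^{\dagger_3}=\bar z-j\bar w=e_1\overline{z_1}+e_2\overline{z_2}$. Hyperbolic numbers: $\mathbb D=\{e_1\alpha_1+e_2\alpha_2:\alpha_1,\alpha_2\in\mathbb R\}$, $\mathbb D^+=\{e_1\alpha_1+e_2\alpha_2:\alpha_1,\alpha_2\ge 0\}$, and $\alpha\leq'\beta$ means $\beta-\alpha\in\mathbb D^+$. The hyperbolic modulus is $|Z|_k=e_1|z_1|+e_2|z_2|\in\mathbb D^+$. A bicomplex algebra $\mathcal A$ is a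 $\mathbb{BC}$-module with an associative, distributive multiplication satisfying $\lambda(xy)=(\lambda x)y=x(\lambda y)$ for $\lambda\in\mathbb{BC}$. A $\mathbb D$-valued norm is a map $\|\cdot\|_{\mathbb D}:\mathcal A\to\mathbb D^+$ with $\|x\|_{\mathbb D}=0$ iff $x=0$, $\|\lambda x\|_{\mathbb D}=|\lambda|_k\|x\|_{\mathbb D}$ and $\|x+y\|_{\mathbb D}\leq'\|x\|_{\mathbb D}+\|y\|_{\mathbb D}$. With $\mathcal A_l=e_l\mathcal A$ (complex algebras over $\mathbb C(i)$), each $x$ is uniquely $x=e_1x_1+e_2x_2$ with $x_l\in\mathcal A_l$, and $\|x\|_{\mathbb D}=e_1\|x_1\|_1+e_2\|x_2\|_2$ with $\|\cdot\|_l$ a norm on $\mathcal A_l$. An involution on $\mathcal A$ is a map $x\mapsto x^*$ with $(x^* )^*=x$, $(xy)^*=y^*x^*$, $(\lambda x+y)^*=\lambda^{\dagger_3}x^*+y^*$ for $\lambda\in\mathbb{BC}$; it restricts to an involution on each $\mathcal A_l$, with $x^*=e_1x_1^*+e_2x_2^*$. $\mathcal A$ is a $\mathbb D$-normed bicomplex Banach algebra if it is complete with respect to $\|\cdot\|_{\mathbb D}$ and $\|xy\|_{\mathbb D}\leq'\|x\|_{\mathbb D}\|y\|_{\mathbb D}$ for all $x,y$. It is a $\mathbb D$-normed bicomplex $C^*$-algebra if in addition it has an involution with $\|x^*x\|_{\mathbb D}=\|x\|_{\mathbb D}^2$ for all $x$. Algebras are not assumed unital. *)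

theory Defs
  imports "HOL-Analysis.Analysis"
begin

section \<open>Bicomplex and hyperbolic numbers\<close>

text \<open>\<open>Bicomplex z w\<close> stands for \<open>z + j w\<close> with \<open>z, w\<close> in \<open>C(i)\<close>.\<close>

datatype bicomplex = Bicomplex (bc_z: complex) (bc_w: complex)

instantiation bicomplex :: comm_ring_1
begin

definition zero_bicomplex :: bicomplex where
  "0 = Bicomplex 0 0"

definition one_bicomplex :: bicomplex where
  "1 = Bicomplex 1 0"

definition plus_bicomplex :: "bicomplex \<Rightarrow> bicomplex \<Rightarrow> bicomplex" where
  "Z + W = Bicomplex (bc_z Z + bc_z W) (bc_w Z + bc_w W)"

definition uminus_bicomplex :: "bicomplex \<Rightarrow> bicomplex" where
  "- Z = Bicomplex (- bc_z Z) (- bc_w Z)"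

definition minus_bicomplex :: "bicomplex \<Rightarrow> bicomplex \<Rightarrow> bicomplex" where
  "Z - W = Bicomplex (bc_z Z - bc_z W) (bc_w Z - bc_w W)"

definition times_bicomplex :: "bicomplex \<Rightarrow> bicomplex \<Rightarrow> bicomplex" where
  "Z * W = Bicomplex (bc_z Z * bc_z W - bc_w Z * bc_w W)
                     (bc_z Z * bc_w W + bc_w Z * bc_z W)"

instance
  by standard
    (simp_all add: zero_bicomplex_def one_bicomplex_def plus_bicomplex_def
      uminus_bicomplex_def minus_bicomplex_def times_bicomplex_def
      bicomplex.expand algebra_simps)

end

lemmas bicomplex_arith_defs =
  zero_bicomplex_def one_bicomplex_def plus_bicomplex_def
  uminus_bicomplex_def minus_bicomplex_def times_bicomplex_def

definition bc_of_complex :: "complex \<Rightarrow> bicomplex" where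
  "bc_of_complex c = Bicomplex c 0"

definition bc_i :: bicomplex where
  "bc_i = bc_of_complex \<i>"

definition bc_j :: bicomplex where
  "bc_j = Bicomplex 0 1"

definition bc_e1 :: bicomplex where
  "bc_e1 = bc_of_complex (1 / 2) * (1 + bc_i * bc_j)"

definition bc_e2 :: bicomplex where
  "bc_e2 = bc_of_complex (1 / 2) * (1 - bc_i * bc_j)"

text \<open>The idempotent coordinates \<open>z\<^sub>1, z\<^sub>2\<close> of \<open>Z = e\<^sub>1 z\<^sub>1 + e\<^sub>2 z\<^sub>2\<close>.\<close>

definition bc_proj1 :: "bicomplex \<Rightarrow> complex" where
  "bc_proj1 Z = bc_z Z - \<i> * bc_w Z"

definition bc_proj2 :: "bicomplex \<Rightarrow> complex" where
  "bc_proj2 Z = bc_z Z + \<i> * bc_w Z"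

definition bc_dagger3 :: "bicomplex \<Rightarrow> bicomplex" where
  "bc_dagger3 Z = Bicomplex (cnj (bc_z Z)) (- cnj (bc_w Z))"

definition hyp :: "real \<Rightarrow> real \<Rightarrow> bicomplex" where
  "hyp a b = bc_e1 * bc_of_complex (complex_of_real a) + bc_e2 * bc_of_complex (complex_of_real b)"

definition hyp_nonneg :: "bicomplex set" where
  "hyp_nonneg = {hyp a b | a b. 0 \<le> a \<and> 0 \<le> b}"

definition hyp_le :: "bicomplex \<Rightarrow> bicomplex \<Rightarrow> bool"  (infix "\<le>''" 50) where
  "\<alpha> \<le>' \<beta> \<longleftrightarrow> \<beta> - \<alpha> \<in> hyp_nonneg"

definition hyp_modulus :: "bicomplex \<Rightarrow> bicomplex" where
  "hyp_modulus Z = hyp (cmod (bc_proj1 Z)) (cmod (bc_proj2 Z))"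

lemma bc_i_squared: "bc_i * bc_i = - 1"
  and bc_j_squared: "bc_j * bc_j = - 1"
  by (simp_all add: bc_i_def bc_j_def bc_of_complex_def bicomplex_arith_defs)

lemma bicomplex_eq: "Z = bc_of_complex (bc_z Z) + bc_j * bc_of_complex (bc_w Z)"
  by (simp add: bc_j_def bc_of_complex_def bicomplex_arith_defs)

lemma bc_e1_eq: "bc_e1 = Bicomplex (1 / 2) (\<i> / 2)"
  and bc_e2_eq: "bc_e2 = Bicomplex (1 / 2) (- \<i> / 2)"
  by (simp_all add: bc_e1_def bc_e2_def bc_i_def bc_j_def bc_of_complex_def bicomplex_arith_defs)

lemma bc_e1_idem: "bc_e1 * bc_e1 = bc_e1"
  and bc_e2_idem: "bc_e2 * bc_e2 = bc_e2"
  and bc_e1_e2: "bc_e1 * bc_e2 = 0"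
  and bc_e1_plus_e2: "bc_e1 + bc_e2 = 1"
  by (simp_all add: bc_e1_eq bc_e2_eq bicomplex_arith_defs)

lemma bc_idempotent_decomposition:
  "Z = bc_e1 * bc_of_complex (bc_proj1 Z) + bc_e2 * bc_of_complex (bc_proj2 Z)"
  by (cases Z) (simp add: bc_e1_eq bc_e2_eq bc_proj1_def bc_proj2_def bc_of_complex_def
      bicomplex_arith_defs field_simps)

lemma bc_proj_hyp [simp]:
  "bc_proj1 (hyp a b) = complex_of_real a" "bc_proj2 (hyp a b) = complex_of_real b"
  by (simp_all add: hyp_def bc_e1_eq bc_e2_eq bc_proj1_def bc_proj2_def bc_of_complex_def
      bicomplex_arith_defs field_simps)

lemma bc_proj_dagger3:
  "bc_proj1 (bc_dagger3 Z) = cnj (bc_proj1 Z)" "bc_proj2 (bc_dagger3 Z) = cnj (bc_proj2 Z)"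
  by (simp_all add: bc_dagger3_def bc_proj1_def bc_proj2_def)


section \<open>Bicomplex algebras\<close>

text \<open>
  The algebra is a whole type. The class \<^class>\<open>ring\<close> supplies its addition and its
  associative, distributive multiplication; no unit and no commutativity are assumed.
\<close>

locale bicomplex_algebra = module smul
  for smul :: "bicomplex \<Rightarrow> 'a::ring \<Rightarrow> 'a" +
  assumes scale_mult_left: "smul c (x * y) = smul c x * y"
    and scale_mult_right: "smul c (x * y) = x * smul c y"

locale D_valued_norm =
  fixes smul :: "bicomplex \<Rightarrow> 'a::ring \<Rightarrow> 'a" and nrm :: "'a \<Rightarrow> bicomplex"
  assumes nrm_nonneg: "nrm x \<in> hyp_nonneg"
    and nrm_eq_0_iff: "nrm x = 0 \<longleftrightarrow> x = 0"
    and nrm_scale: "nrm (smul c x) = hyp_modulus c * nrm x"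
    and nrm_triangle: "nrm (x + y) \<le>' nrm x + nrm y"

locale bicomplex_involution =
  fixes smul :: "bicomplex \<Rightarrow> 'a::ring \<Rightarrow> 'a" and star :: "'a \<Rightarrow> 'a"
  assumes star_star: "star (star x) = x"
    and star_mult: "star (x * y) = star y * star x"
    and star_linear: "star (smul c x + y) = smul (bc_dagger3 c) (star x) + star y"

text \<open>
  In the following notions the tolerance \<open>hyp a b\<close> is strictly positive in both
  idempotent components; a zero divisor such as \<open>e\<^sub>1\<close> is not admitted, since it would
  force exact equality in the other component.
\<close>

definition D_Cauchy :: "('a::ring \<Rightarrow> bicomplex) \<Rightarrow> (nat \<Rightarrow> 'a) \<Rightarrow> bool" where
  "D_Cauchy nrm X \<longleftrightarrow>
    (\<forall>a>0. \<forall>b>0. \<exists>N. \<forall>m\<ge>N. \<forall>n\<ge>N. nrm (X m - X n) \<le>' hyp a b)"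

definition D_converges_to :: "('a::ring \<Rightarrow> bicomplex) \<Rightarrow> (nat \<Rightarrow> 'a) \<Rightarrow> 'a \<Rightarrow> bool" where
  "D_converges_to nrm X x \<longleftrightarrow>
    (\<forall>a>0. \<forall>b>0. \<exists>N. \<forall>n\<ge>N. nrm (X n - x) \<le>' hyp a b)"

definition D_complete :: "('a::ring \<Rightarrow> bicomplex) \<Rightarrow> bool" where
  "D_complete nrm \<longleftrightarrow> (\<forall>X. D_Cauchy nrm X \<longrightarrow> (\<exists>x. D_converges_to nrm X x))"

locale D_normed_bicomplex_Banach_algebra =
  bicomplex_algebra smul + D_valued_norm smul nrm
  for smul :: "bicomplex \<Rightarrow> 'a::ring \<Rightarrow> 'a" and nrm :: "'a \<Rightarrow> bicomplex" +
  assumes complete: "D_complete nrm"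
    and nrm_mult: "nrm (x * y) \<le>' nrm x * nrm y"

locale D_normed_bicomplex_Cstar_algebra =
  D_normed_bicomplex_Banach_algebra smul nrm + bicomplex_involution smul star
  for smul :: "bicomplex \<Rightarrow> 'a::ring \<Rightarrow> 'a" and nrm :: "'a \<Rightarrow> bicomplex" and star :: "'a \<Rightarrow> 'a" +
  assumes Cstar_identity: "nrm (star x * x) = (nrm x)\<^sup>2"


section \<open>Complex C*-algebras on a carrier set\<close>

text \<open>
  The carrier \<open>S\<close> lies in a type of class \<^class>\<open>ring\<close>, whose addition and multiplication
  it inherits. The operations \<open>cscale\<close>, \<open>nrm\<close> and \<open>star\<close> matter only on \<open>S\<close>.
\<close>

locale complex_algebra_on =
  fixes S :: "'a::ring set" and cscale :: "complex \<Rightarrow> 'a \<Rightarrow> 'a"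
  assumes zero_mem: "0 \<in> S"
    and add_mem: "x \<in> S \<Longrightarrow> y \<in> S \<Longrightarrow> x + y \<in> S"
    and uminus_mem: "x \<in> S \<Longrightarrow> - x \<in> S"
    and mult_mem: "x \<in> S \<Longrightarrow> y \<in> S \<Longrightarrow> x * y \<in> S"
    and cscale_mem: "x \<in> S \<Longrightarrow> cscale c x \<in> S"
    and cscale_add_right: "x \<in> S \<Longrightarrow> y \<in> S \<Longrightarrow> cscale c (x + y) = cscale c x + cscale c y"
    and cscale_add_left: "x \<in> S \<Longrightarrow> cscale (c + d) x = cscale c x + cscale d x"
    and cscale_cscale: "x \<in> S \<Longrightarrow> cscale c (cscale d x) = cscale (c * d) x"
    and cscale_one: "x \<in> S \<Longrightarrow> cscale 1 x = x"
    and cscale_mult_left: "x \<in> S \<Longrightarrow> y \<in> S \<Longrightarrow> cscale c (x * y) = cscale c x * y"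
    and cscale_mult_right: "x \<in> S \<Longrightarrow> y \<in> S \<Longrightarrow> cscale c (x * y) = x * cscale c y"

locale complex_norm_on =
  fixes S :: "'a::ring set" and cscale :: "complex \<Rightarrow> 'a \<Rightarrow> 'a" and nrm :: "'a \<Rightarrow> real"
  assumes nrm_nonneg: "x \<in> S \<Longrightarrow> 0 \<le> nrm x"
    and nrm_eq_0_iff: "x \<in> S \<Longrightarrow> nrm x = 0 \<longleftrightarrow> x = 0"
    and nrm_cscale: "x \<in> S \<Longrightarrow> nrm (cscale c x) = cmod c * nrm x"
    and nrm_triangle: "x \<in> S \<Longrightarrow> y \<in> S \<Longrightarrow> nrm (x + y) \<le> nrm x + nrm y"

locale complex_involution_on =
  fixes S :: "'a::ring set" and cscale :: "complex \<Rightarrow> 'a \<Rightarrow> 'a" and star :: "'a \<Rightarrow> 'a"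
  assumes star_mem: "x \<in> S \<Longrightarrow> star x \<in> S"
    and star_star: "x \<in> S \<Longrightarrow> star (star x) = x"
    and star_mult: "x \<in> S \<Longrightarrow> y \<in> S \<Longrightarrow> star (x * y) = star y * star x"
    and star_linear: "x \<in> S \<Longrightarrow> y \<in> S \<Longrightarrow> star (cscale c x + y) = cscale (cnj c) (star x) + star y"

locale complex_Banach_algebra_on =
  complex_algebra_on S cscale + complex_norm_on S cscale nrm
  for S :: "'a::ring set" and cscale :: "complex \<Rightarrow> 'a \<Rightarrow> 'a" and nrm :: "'a \<Rightarrow> real" +
  assumes complete: "Metric_space.mcomplete S (\<lambda>x y. nrm (x - y))"
    and nrm_mult: "x \<in> S \<Longrightarrow> y \<in> S \<Longrightarrow> nrm (x * y) \<le> nrm x * nrm y"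

locale complex_Cstar_algebra_on =
  complex_Banach_algebra_on S cscale nrm + complex_involution_on S cscale star
  for S :: "'a::ring set" and cscale :: "complex \<Rightarrow> 'a \<Rightarrow> 'a"
    and nrm :: "'a \<Rightarrow> real" and star :: "'a \<Rightarrow> 'a" +
  assumes Cstar_identity: "x \<in> S \<Longrightarrow> nrm (star x * x) = (nrm x)\<^sup>2"


section \<open>Idempotent components of a bicomplex algebra\<close>

definition idem_part :: "(bicomplex \<Rightarrow> 'a::ring \<Rightarrow> 'a) \<Rightarrow> bicomplex \<Rightarrow> 'a set" where
  "idem_part smul e = range (smul e)"

definition complex_scale :: "(bicomplex \<Rightarrow> 'a::ring \<Rightarrow> 'a) \<Rightarrow> complex \<Rightarrow> 'a \<Rightarrow> 'a" where
  "complex_scale smul c x = smul (bc_of_complex c) x"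

text \<open>
  The idempotent coordinates of a value of a \<open>D\<close>-valued norm are real, so \<^const>\<open>Re\<close>
  only changes the type.
\<close>

definition norm_part1 :: "('a::ring \<Rightarrow> bicomplex) \<Rightarrow> 'a \<Rightarrow> real" where
  "norm_part1 nrm x = Re (bc_proj1 (nrm x))"

definition norm_part2 :: "('a::ring \<Rightarrow> bicomplex) \<Rightarrow> 'a \<Rightarrow> real" where
  "norm_part2 nrm x = Re (bc_proj2 (nrm x))"

lemma bc_proj_mult:
  "bc_proj1 (Z * W) = bc_proj1 Z * bc_proj1 W" "bc_proj2 (Z * W) = bc_proj2 Z * bc_proj2 W"
  by (simp_all add: bc_proj1_def bc_proj2_def times_bicomplex_def complex_eq_iff algebra_simps)

lemma bc_proj_e:
  "bc_proj1 bc_e1 = 1" "bc_proj2 bc_e1 = 0" "bc_proj1 bc_e2 = 0" "bc_proj2 bc_e2 = 1"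
  by (simp_all add: bc_proj1_def bc_proj2_def bc_e1_eq bc_e2_eq)

lemma (in D_valued_norm) nrm_idempotent_decomposition:
  "nrm x = hyp (norm_part1 nrm (smul bc_e1 x)) (norm_part2 nrm (smul bc_e2 x))"
proof -
  obtain a b where ab: "nrm x = hyp a b"
    using nrm_nonneg[of x] by (auto simp: hyp_nonneg_def)
  have "norm_part1 nrm (smul bc_e1 x) = a" "norm_part2 nrm (smul bc_e2 x) = b"
    by (simp_all add: norm_part1_def norm_part2_def nrm_scale hyp_modulus_def bc_proj_mult bc_proj_e ab)
  with ab show ?thesis by simp
qed

end

theory Submission
  imports Defs
begin

text \<open>
  Both sides are compared with one intermediate statement about the two coordinates
  \<open>N\<^sub>1, N\<^sub>2\<close> of the norm, regarded as seminorms on all of \<open>\<A>\<close>. Since \<open>N\<^sub>l x = N\<^sub>l (e\<^sub>l x)\<close>,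
  and \<open>e\<^sub>l\<close> is an idempotent that commutes with the multiplication and with the involution,
  completeness, submultiplicativity and the \<open>C\<^sup>*\<close>-identity hold for \<open>N\<^sub>l\<close> on \<open>\<A>\<close> iff they
  hold on \<open>e\<^sub>l \<A>\<close>. The hyperbolic operations and order act coordinatewise, so the same
  three properties of the \<open>\<D>\<close>-valued norm amount to those of \<open>N\<^sub>1\<close> and \<open>N\<^sub>2\<close> together.
\<close>

section \<open>Arithmetic, order and conjugation in idempotent coordinates\<close>

lemma hyp_eq_iff: "hyp a b = hyp c d \<longleftrightarrow> a = c \<and> b = d"
  by (metis bc_proj_hyp of_real_eq_iff)

lemma hyp_add: "hyp a b + hyp c d = hyp (a + c) (b + d)"
  by (simp add: hyp_def bc_of_complex_def bc_e1_eq bc_e2_eq bicomplex_arith_defs algebra_simps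
      add_divide_distrib)

lemma hyp_diff: "hyp a b - hyp c d = hyp (a - c) (b - d)"
  by (simp add: hyp_def bc_of_complex_def bc_e1_eq bc_e2_eq bicomplex_arith_defs algebra_simps
      diff_divide_distrib)

lemma hyp_mult: "hyp a b * hyp c d = hyp (a * c) (b * d)"
  by (simp add: hyp_def bc_of_complex_def bc_e1_eq bc_e2_eq bicomplex_arith_defs field_simps)

lemma hyp_zero: "hyp 0 0 = 0"
  by (simp add: hyp_def bc_of_complex_def bc_e1_eq bc_e2_eq bicomplex_arith_defs)

lemma hyp_le_hyp_iff: "hyp a b \<le>' hyp c d \<longleftrightarrow> a \<le> c \<and> b \<le> d"
  by (auto simp: hyp_le_def hyp_diff hyp_nonneg_def hyp_eq_iff)

lemma bc_proj_of_complex: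
  "bc_proj1 (bc_of_complex c) = c" "bc_proj2 (bc_of_complex c) = c"
  by (simp_all add: bc_proj1_def bc_proj2_def bc_of_complex_def)

lemma bc_of_complex_add: "bc_of_complex (c + d) = bc_of_complex c + bc_of_complex d"
  and bc_of_complex_mult: "bc_of_complex (c * d) = bc_of_complex c * bc_of_complex d"
  and bc_of_complex_1: "bc_of_complex 1 = 1"
  and bc_dagger3_of_complex: "bc_dagger3 (bc_of_complex c) = bc_of_complex (cnj c)"
  by (simp_all add: bc_of_complex_def bc_dagger3_def bicomplex_arith_defs)

text \<open>This conjugation negates both i and j, hence fixes ij and with it both idempotents. For
  this reason the involution maps each component into itself.\<close>

lemma bc_dagger3_e: "bc_dagger3 bc_e1 = bc_e1" "bc_dagger3 bc_e2 = bc_e2"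
  by (simp_all add: bc_e1_eq bc_e2_eq bc_dagger3_def)

text \<open>Stated on the whole type, so that no carrier has to be tracked; limits need not be
  unique. The bounds are non-strict to match \<open>D_Cauchy\<close> and
  \<open>D_converges_to\<close>.\<close>

definition seminorm_complete :: "('a::ring \<Rightarrow> real) \<Rightarrow> bool" where
  "seminorm_complete n \<longleftrightarrow>
    (\<forall>X :: nat \<Rightarrow> 'a. (\<forall>a>0. \<exists>N. \<forall>k\<ge>N. \<forall>l\<ge>N. n (X k - X l) \<le> a) \<longrightarrow>
      (\<exists>x. \<forall>a>0. \<exists>N. \<forall>k\<ge>N. n (X k - x) \<le> a))"

lemma seminorm_completeD:
  fixes X :: "nat \<Rightarrow> 'a::ring"
  assumes "seminorm_complete n" and "\<forall>a>0. \<exists>N. \<forall>k\<ge>N. \<forall>l\<ge>N. n (X k - X l) \<le> a"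
  obtains x where "\<forall>a>0. \<exists>N. \<forall>k\<ge>N. n (X k - x) \<le> a"
  using assms(1)[unfolded seminorm_complete_def, THEN spec, of X] assms(2) that by (elim impE exE)

text \<open>The involution locale carries no module laws, so they enter as a premise; they remove
  the scalar 1 from \<open>star_linear\<close>.\<close>

lemma (in bicomplex_involution) star_add: "star (x + y) = star x + star y"
  if "module smul"
proof -
  interpret module smul by fact
  have "bc_dagger3 1 = 1"
    by (simp add: bc_dagger3_def one_bicomplex_def)
  then show ?thesis
    using star_linear[of 1 x y] by simp
qed

lemma (in bicomplex_involution) star_smul: "star (smul c x) = smul (bc_dagger3 c) (star x)"
  if "module smul"
proof -
  have "star 0 = 0"
    using star_add[OF that, of 0 0] by simp
  then show ?thesis
    using star_linear[of c x 0] by simp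
qed

text \<open>Abstracts over the two components: \<open>p\<close> is a coordinate map, \<open>n\<close> that coordinate of the norm.\<close>

locale idempotent_component =
  bicomplex_algebra smul + bicomplex_involution smul star
  for smul :: "bicomplex \<Rightarrow> 'a::ring \<Rightarrow> 'a" and star :: "'a \<Rightarrow> 'a" +
  fixes e :: bicomplex and p :: "bicomplex \<Rightarrow> complex" and n :: "'a \<Rightarrow> real"
  assumes e_idem: "e * e = e"
    and dagger3_e: "bc_dagger3 e = e"
    and p_e: "p e = 1"
    and p_of_complex: "p (bc_of_complex d) = d"
    and n_nonneg: "0 \<le> n x"
    and n_smul: "n (smul c x) = cmod (p c) * n x"
    and n_triangle: "n (x + y) \<le> n x + n y"
    and n_eq_0D: "n x = 0 \<Longrightarrow> smul e x = 0"
begin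

section \<open>One idempotent component as a complex algebra\<close>

abbreviation part :: "'a set" where
  "part \<equiv> idem_part smul e"

lemma smul_e_in_part: "smul e x \<in> part"
  by (simp add: idem_part_def)

text \<open>Replaces membership in a range by an equation, so that closure under the operations
  becomes rewriting.\<close>

lemma part_iff: "x \<in> part \<longleftrightarrow> smul e x = x"
proof
  assume "x \<in> part"
  then show "smul e x = x"
    by (auto simp: idem_part_def e_idem)
next
  assume "smul e x = x"
  then show "x \<in> part"
    by (metis smul_e_in_part)
qed

text \<open>Both scalars move out of the product and merge by idempotency. Together with
  \<open>star_e\<close> and \<open>n_e\<close> this carries statements about products between
  \<open>part\<close> and the whole algebra.\<close>

lemma e_mult_e: "smul e x * smul e y = smul e (x * y)"
  by (metis scale_mult_left scale_mult_right scale_scale e_idem)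

lemma star_e: "star (smul e x) = smul e (star x)"
  by (simp add: star_smul module_axioms dagger3_e)

lemma n_e: "n (smul e x) = n x"
  by (simp add: n_smul p_e)

lemma n_zero: "n 0 = 0"
  using n_smul[of "bc_of_complex 0" 0] by (simp add: p_of_complex)

lemma n_minus_commute: "n (x - y) = n (y - x)"
proof -
  \<comment> \<open>The locale gives the value of \<open>p\<close> only at \<open>e\<close> and at
    complex scalars, so negation is written as scaling by the complex number -1.\<close>
  have "bc_of_complex (- 1) = - 1"
    by (simp add: bc_of_complex_def bicomplex_arith_defs)
  then have "- z = smul (bc_of_complex (- 1)) z" for z
    by simp
  then have "n (- z) = n z" for z
    by (simp only: n_smul p_of_complex) simp
  from this[of "x - y"] show ?thesis by simp
qed

lemma n_eq_0_iff: "n x = 0 \<longleftrightarrow> x = 0" if "x \<in> part"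
  using that n_eq_0D[of x] by (auto simp: part_iff n_zero)

lemma complex_algebra_on_part: "complex_algebra_on part (complex_scale smul)"
proof
  fix c x assume "x \<in> part"
  then show "complex_scale smul c x \<in> part"
    by (metis complex_scale_def mult.commute part_iff scale_scale)
next
  fix x y assume "x \<in> part" "y \<in> part"
  then show "x * y \<in> part"
    by (metis e_mult_e part_iff)
qed (auto simp: part_iff complex_scale_def scale_right_distrib scale_left_distrib bc_of_complex_add
    bc_of_complex_mult bc_of_complex_1 simp flip: scale_mult_left scale_mult_right)

lemma complex_norm_on_part: "complex_norm_on part (complex_scale smul) n"
  by standard (auto simp: n_nonneg n_eq_0_iff complex_scale_def n_smul p_of_complex n_triangle)

lemma complex_involution_on_part: "complex_involution_on part (complex_scale smul) star"
  by standard
    (auto simp: part_iff star_star star_mult complex_scale_def star_linear bc_dagger3_of_complex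
      simp flip: star_e)

text \<open>Symmetry and the triangle inequality hold on the whole algebra; definiteness is where
  the carrier enters, through its closure under differences.\<close>

lemma Metric_space_part: "Metric_space part (\<lambda>x y. n (x - y))"
proof
  fix x y assume "x \<in> part" "y \<in> part"
  then have "x - y \<in> part"
    by (simp add: part_iff scale_right_diff_distrib)
  then show "n (x - y) = 0 \<longleftrightarrow> x = y"
    by (simp add: n_eq_0_iff)
next
  fix x y z
  show "n (x - z) \<le> n (x - y) + n (y - z)"
    using n_triangle[of "x - y" "y - z"] by simp
qed (auto simp: n_nonneg intro: n_minus_commute)

text \<open>Projection by \<open>e\<close> preserves all \<open>n\<close>-distances. It therefore
  sends a Cauchy sequence of the algebra to one in \<open>part\<close>, and a seminorm limit
  \<open>x\<close> of a sequence in \<open>part\<close> to a genuine limit \<open>smul e x\<close>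
  there.\<close>

lemma mcomplete_part_iff:
  "Metric_space.mcomplete part (\<lambda>x y. n (x - y)) \<longleftrightarrow> seminorm_complete n"
proof -
  interpret M: Metric_space part "\<lambda>x y. n (x - y)"
    by (rule Metric_space_part)
  \<comment> \<open>Metric spaces use strict bounds. A non-strict bound at a smaller positive
    tolerance yields a strict one.\<close>
  have less_iff_le: "(\<forall>a>0. \<exists>N. \<forall>k\<ge>N. f k < a) \<longleftrightarrow> (\<forall>a>0. \<exists>N. \<forall>k\<ge>N. f k \<le> a)"
    for f :: "nat \<Rightarrow> real"
    by (meson field_lbound_gt_zero le_less_trans less_imp_le)
  have less_iff_le2: "(\<forall>a>0. \<exists>N. \<forall>k l. N \<le> k \<longrightarrow> N \<le> l \<longrightarrow> f k l < a) \<longleftrightarrow>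
      (\<forall>a>0. \<exists>N. \<forall>k\<ge>N. \<forall>l\<ge>N. f k l \<le> a)"
    for f :: "nat \<Rightarrow> nat \<Rightarrow> real"
    by (meson field_lbound_gt_zero le_less_trans less_imp_le)
  have cauchy: "M.MCauchy X \<longleftrightarrow> range X \<subseteq> part \<and>
      (\<forall>a>0. \<exists>N. \<forall>k\<ge>N. \<forall>l\<ge>N. n (X k - X l) \<le> a)" for X :: "nat \<Rightarrow> 'a"
    unfolding M.MCauchy_def less_iff_le2 ..
  have lim: "limitin M.mtopology X x sequentially \<longleftrightarrow>
      x \<in> part \<and> (\<forall>a>0. \<exists>N. \<forall>k\<ge>N. n (X k - x) \<le> a)" if "range X \<subseteq> part"
    for X :: "nat \<Rightarrow> 'a" and x
    using that by (auto simp: M.limit_metric_sequentially range_subsetD simp flip: less_iff_le)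
  have e_diff: "n (smul e x - smul e y) = n (x - y)" for x y
    by (metis n_e scale_right_diff_distrib)
  \<comment> \<open>Projecting \<open>smul e x - y\<close> once more gives
    \<open>smul e x - smul e y\<close>, so it suffices to project one argument.\<close>
  have e_diff': "n (smul e x - y) = n (x - y)" "n (y - smul e x) = n (y - x)"
    for x y
    using e_diff[of x "smul e y"] e_diff[of x y] e_diff[of "smul e x" y]
    by (metis e_idem n_e scale_right_diff_distrib scale_scale)+
  show ?thesis
  proof
    assume complete: "M.mcomplete"
    show "seminorm_complete n"
      unfolding seminorm_complete_def
    proof (intro allI impI)
      fix X :: "nat \<Rightarrow> 'a"
      assume "\<forall>a>0. \<exists>N. \<forall>k\<ge>N. \<forall>l\<ge>N. n (X k - X l) \<le> a"
      then have "M.MCauchy (\<lambda>k. smul e (X k))"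
        by (auto simp: cauchy e_diff smul_e_in_part)
      with complete obtain x where "limitin M.mtopology (\<lambda>k. smul e (X k)) x sequentially"
        by (auto simp: M.mcomplete_def)
      then have "\<forall>a>0. \<exists>N. \<forall>k\<ge>N. n (smul e (X k) - x) \<le> a"
        by (subst (asm) lim) (auto simp: smul_e_in_part)
      then show "\<exists>x. \<forall>a>0. \<exists>N. \<forall>k\<ge>N. n (X k - x) \<le> a"
        by (auto simp: e_diff')
    qed
  next
    assume complete: "seminorm_complete n"
    show "M.mcomplete"
      unfolding M.mcomplete_def
    proof (intro allI impI)
      fix X assume X: "M.MCauchy X"
      then obtain x where "\<forall>a>0. \<exists>N. \<forall>k\<ge>N. n (X k - x) \<le> a"
        unfolding cauchy by (elim conjE seminorm_completeD[OF complete])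
      with X have "limitin M.mtopology X (smul e x) sequentially"
        by (auto simp: cauchy lim smul_e_in_part e_diff')
      then show "\<exists>x. limitin M.mtopology X x sequentially" ..
    qed
  qed
qed

text \<open>The algebra, norm and involution axioms already hold on \<open>part\<close>; three
  conditions remain. The two on products extend to all arguments because both sides keep their
  values when the arguments are projected by \<open>e\<close>.\<close>

lemma complex_Cstar_algebra_on_part_iff:
  "complex_Cstar_algebra_on part (complex_scale smul) n star \<longleftrightarrow>
    seminorm_complete n \<and> (\<forall>x y. n (x * y) \<le> n x * n y) \<and> (\<forall>x. n (star x * x) = (n x)\<^sup>2)"
proof -
  have "(\<forall>x y. x \<in> part \<longrightarrow> y \<in> part \<longrightarrow> n (x * y) \<le> n x * n y) \<longleftrightarrow>
      (\<forall>x y. n (x * y) \<le> n x * n y)"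
    by (metis smul_e_in_part e_mult_e n_e)
  moreover have "(\<forall>x. x \<in> part \<longrightarrow> n (star x * x) = (n x)\<^sup>2) \<longleftrightarrow> (\<forall>x. n (star x * x) = (n x)\<^sup>2)"
    by (metis smul_e_in_part e_mult_e n_e star_e)
  ultimately show ?thesis
    by (auto simp: complex_Cstar_algebra_on_def complex_Cstar_algebra_on_axioms_def
        complex_Banach_algebra_on_def complex_Banach_algebra_on_axioms_def
        complex_algebra_on_part complex_norm_on_part complex_involution_on_part mcomplete_part_iff)
qed

end

section \<open>The hyperbolic norm split into its two real coordinates\<close>

context D_valued_norm
begin

lemma nrm_eq_hyp: "nrm x = hyp (norm_part1 nrm x) (norm_part2 nrm x)"
  using nrm_nonneg[of x] by (auto simp: hyp_nonneg_def norm_part1_def norm_part2_def)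

lemma norm_part_nonneg: "0 \<le> norm_part1 nrm x" "0 \<le> norm_part2 nrm x"
  using nrm_nonneg[of x] by (auto simp: hyp_nonneg_def norm_part1_def norm_part2_def)

lemma norm_part_triangle:
  "norm_part1 nrm (x + y) \<le> norm_part1 nrm x + norm_part1 nrm y"
  "norm_part2 nrm (x + y) \<le> norm_part2 nrm x + norm_part2 nrm y"
  using nrm_triangle[of x y] by (simp_all add: nrm_eq_hyp hyp_add hyp_le_hyp_iff)

lemma norm_part_smul:
  "norm_part1 nrm (smul c x) = cmod (bc_proj1 c) * norm_part1 nrm x"
  "norm_part2 nrm (smul c x) = cmod (bc_proj2 c) * norm_part2 nrm x"
  using nrm_scale[of c x] by (simp_all add: nrm_eq_hyp hyp_modulus_def hyp_mult hyp_eq_iff)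

lemma norm_parts_eq_0_iff: "norm_part1 nrm x = 0 \<and> norm_part2 nrm x = 0 \<longleftrightarrow> x = 0"
  using nrm_eq_0_iff[of x] by (metis hyp_eq_iff hyp_zero nrm_eq_hyp)

lemma nrm_le_hyp_iff: "nrm x \<le>' hyp a b \<longleftrightarrow> norm_part1 nrm x \<le> a \<and> norm_part2 nrm x \<le> b"
  by (simp add: nrm_eq_hyp hyp_le_hyp_iff)

lemma D_Cauchy_iff:
  "D_Cauchy nrm X \<longleftrightarrow>
    (\<forall>a>0. \<exists>N. \<forall>k\<ge>N. \<forall>l\<ge>N. norm_part1 nrm (X k - X l) \<le> a) \<and>
    (\<forall>a>0. \<exists>N. \<forall>k\<ge>N. \<forall>l\<ge>N. norm_part2 nrm (X k - X l) \<le> a)" (is "?D \<longleftrightarrow> ?C1 \<and> ?C2")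
proof
  assume ?D
  then show "?C1 \<and> ?C2"
    \<comment> \<open>Setting the other tolerance to 1 isolates one coordinate.\<close>
    unfolding D_Cauchy_def nrm_le_hyp_iff by (meson zero_less_one)
next
  assume C: "?C1 \<and> ?C2"
  show ?D
    unfolding D_Cauchy_def nrm_le_hyp_iff
  proof (intro allI impI)
    fix a b :: real assume "0 < a" "0 < b"
    then obtain N M where
      "\<forall>k\<ge>N. \<forall>l\<ge>N. norm_part1 nrm (X k - X l) \<le> a"
      "\<forall>k\<ge>M. \<forall>l\<ge>M. norm_part2 nrm (X k - X l) \<le> b"
      using C by meson
    then show "\<exists>N. \<forall>k\<ge>N. \<forall>l\<ge>N. norm_part1 nrm (X k - X l) \<le> a \<and> norm_part2 nrm (X k - X l) \<le> b"
      by (intro exI[of _ "max N M"]) simp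
  qed
qed

lemma D_converges_to_iff:
  "D_converges_to nrm X x \<longleftrightarrow>
    (\<forall>a>0. \<exists>N. \<forall>k\<ge>N. norm_part1 nrm (X k - x) \<le> a) \<and>
    (\<forall>a>0. \<exists>N. \<forall>k\<ge>N. norm_part2 nrm (X k - x) \<le> a)" (is "?D \<longleftrightarrow> ?C1 \<and> ?C2")
proof
  assume ?D
  then show "?C1 \<and> ?C2"
    unfolding D_converges_to_def nrm_le_hyp_iff by (meson zero_less_one)
next
  assume C: "?C1 \<and> ?C2"
  show ?D
    unfolding D_converges_to_def nrm_le_hyp_iff
  proof (intro allI impI)
    fix a b :: real assume "0 < a" "0 < b"
    then obtain N M where
      "\<forall>k\<ge>N. norm_part1 nrm (X k - x) \<le> a" "\<forall>k\<ge>M. norm_part2 nrm (X k - x) \<le> b"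
      using C by meson
    then show "\<exists>N. \<forall>k\<ge>N. norm_part1 nrm (X k - x) \<le> a \<and> norm_part2 nrm (X k - x) \<le> b"
      by (intro exI[of _ "max N M"]) simp
  qed
qed

lemma D_complete_iff:
  assumes "module smul"
  shows "D_complete nrm \<longleftrightarrow>
    seminorm_complete (norm_part1 nrm) \<and> seminorm_complete (norm_part2 nrm)"
proof -
  interpret module smul by fact
  let ?N1 = "norm_part1 nrm" and ?N2 = "norm_part2 nrm"
  have e1: "?N1 (smul bc_e1 x - smul bc_e1 y) = ?N1 (x - y)"
      "?N2 (smul bc_e1 x - smul bc_e1 y) = 0" for x y
    by (simp_all add: norm_part_smul bc_proj_e flip: scale_right_diff_distrib)
  have e2: "?N2 (smul bc_e2 x - smul bc_e2 y) = ?N2 (x - y)"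
      "?N1 (smul bc_e2 x - smul bc_e2 y) = 0" for x y
    by (simp_all add: norm_part_smul bc_proj_e flip: scale_right_diff_distrib)
  have N_e: "?N1 (smul bc_e1 x) = ?N1 x" "?N2 (smul bc_e2 x) = ?N2 x" for x
    by (simp_all add: norm_part_smul bc_proj_e)
  have e1_y: "?N1 (smul bc_e1 x - y) = ?N1 (x - y)" for x y
    by (metis N_e(1) bc_e1_idem scale_right_diff_distrib scale_scale)
  have e2_y: "?N2 (smul bc_e2 x - y) = ?N2 (x - y)" for x y
    by (metis N_e(2) bc_e2_idem scale_right_diff_distrib scale_scale)
  show ?thesis
  proof
    assume complete: "D_complete nrm"
    have "\<exists>x. \<forall>a>0. \<exists>N. \<forall>k\<ge>N. ?N1 (X k - x) \<le> a"
      if "\<forall>a>0. \<exists>N. \<forall>k\<ge>N. \<forall>l\<ge>N. ?N1 (X k - X l) \<le> a" for X :: "nat \<Rightarrow> 'a"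
    proof -
      \<comment> \<open>The second coordinate of \<open>X\<close> is uncontrolled. Multiplying by
        \<open>bc_e1\<close> makes its differences vanish there and leaves the first coordinate
        unchanged.\<close>
      have "D_Cauchy nrm (\<lambda>k. smul bc_e1 (X k))"
        using that by (auto simp: D_Cauchy_iff e1)
      with complete obtain x where "D_converges_to nrm (\<lambda>k. smul bc_e1 (X k)) x"
        by (auto simp: D_complete_def)
      then show ?thesis
        by (auto simp: D_converges_to_iff e1_y)
    qed
    moreover have "\<exists>x. \<forall>a>0. \<exists>N. \<forall>k\<ge>N. ?N2 (X k - x) \<le> a"
      if "\<forall>a>0. \<exists>N. \<forall>k\<ge>N. \<forall>l\<ge>N. ?N2 (X k - X l) \<le> a" for X :: "nat \<Rightarrow> 'a"
    proof -
      have "D_Cauchy nrm (\<lambda>k. smul bc_e2 (X k))"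
        using that by (auto simp: D_Cauchy_iff e2)
      with complete obtain x where "D_converges_to nrm (\<lambda>k. smul bc_e2 (X k)) x"
        by (auto simp: D_complete_def)
      then show ?thesis
        by (auto simp: D_converges_to_iff e2_y)
    qed
    ultimately show "seminorm_complete ?N1 \<and> seminorm_complete ?N2"
      by (simp add: seminorm_complete_def)
  next
    assume complete: "seminorm_complete ?N1 \<and> seminorm_complete ?N2"
    show "D_complete nrm"
      unfolding D_complete_def
    proof (intro allI impI)
      fix X assume "D_Cauchy nrm X"
      then have cauchy: "\<forall>a>0. \<exists>N. \<forall>k\<ge>N. \<forall>l\<ge>N. ?N1 (X k - X l) \<le> a"
          "\<forall>a>0. \<exists>N. \<forall>k\<ge>N. \<forall>l\<ge>N. ?N2 (X k - X l) \<le> a"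
        by (simp_all add: D_Cauchy_iff)
      obtain x where lim1: "\<forall>a>0. \<exists>N. \<forall>k\<ge>N. ?N1 (X k - x) \<le> a"
        using complete[THEN conjunct1] cauchy(1) by (rule seminorm_completeD)
      obtain y where lim2: "\<forall>a>0. \<exists>N. \<forall>k\<ge>N. ?N2 (X k - y) \<le> a"
        using complete[THEN conjunct2] cauchy(2) by (rule seminorm_completeD)
      \<comment> \<open>The two limits may differ. \<open>z\<close> glues them: the first coordinate
        of the norm sees only the \<open>bc_e1\<close> part of \<open>z\<close>, the second only the
        \<open>bc_e2\<close> part.\<close>
      define z where "z = smul bc_e1 x + smul bc_e2 y"
      have e_z: "smul bc_e1 z = smul bc_e1 x" "smul bc_e2 z = smul bc_e2 y"
        by (simp_all add: z_def scale_right_distrib bc_e1_idem bc_e2_idem bc_e1_e2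
            mult.commute[of bc_e2 bc_e1])
      have "?N1 (w - z) = ?N1 (w - x)" "?N2 (w - z) = ?N2 (w - y)" for w
        by (metis e1(1) e_z(1)) (metis e2(1) e_z(2))
      with lim1 lim2 have "D_converges_to nrm X z"
        by (simp add: D_converges_to_iff)
      then show "\<exists>x. D_converges_to nrm X x" ..
    qed
  qed
qed

text \<open>Each axiom splits because hyperbolic products, squares and order are coordinatewise. The
  conjuncts are grouped by coordinate to match two instances of
  \<open>complex_Cstar_algebra_on_part_iff\<close>.\<close>

lemma D_normed_bicomplex_Cstar_algebra_iff:
  assumes "bicomplex_algebra smul" and "bicomplex_involution smul star"
  shows "D_normed_bicomplex_Cstar_algebra smul nrm star \<longleftrightarrow>
    (seminorm_complete (norm_part1 nrm) \<and>
      (\<forall>x y. norm_part1 nrm (x * y) \<le> norm_part1 nrm x * norm_part1 nrm y) \<and>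
      (\<forall>x. norm_part1 nrm (star x * x) = (norm_part1 nrm x)\<^sup>2)) \<and>
    (seminorm_complete (norm_part2 nrm) \<and>
      (\<forall>x y. norm_part2 nrm (x * y) \<le> norm_part2 nrm x * norm_part2 nrm y) \<and>
      (\<forall>x. norm_part2 nrm (star x * x) = (norm_part2 nrm x)\<^sup>2))"
proof -
  have "module smul"
    using assms(1) by (simp add: bicomplex_algebra_def)
  then show ?thesis
    using assms D_valued_norm_axioms
    by (auto simp: D_normed_bicomplex_Cstar_algebra_def D_normed_bicomplex_Cstar_algebra_axioms_def
        D_normed_bicomplex_Banach_algebra_def D_normed_bicomplex_Banach_algebra_axioms_def
        D_complete_iff nrm_eq_hyp hyp_mult hyp_le_hyp_iff hyp_eq_iff power2_eq_square)
qed

end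

theorem theorem2p8:
  fixes smul :: "bicomplex \<Rightarrow> 'a::ring \<Rightarrow> 'a"
    and nrm :: "'a \<Rightarrow> bicomplex"
    and star :: "'a \<Rightarrow> 'a"
  assumes "bicomplex_algebra smul"
    and "D_valued_norm smul nrm"
    and "bicomplex_involution smul star"
  shows "D_normed_bicomplex_Cstar_algebra smul nrm star \<longleftrightarrow>
    complex_Cstar_algebra_on (idem_part smul bc_e1) (complex_scale smul) (norm_part1 nrm) star \<and>
    complex_Cstar_algebra_on (idem_part smul bc_e2) (complex_scale smul) (norm_part2 nrm) star"
proof -
  interpret A: bicomplex_algebra smul by fact
  interpret N: D_valued_norm smul nrm by fact
  interpret I: bicomplex_involution smul star by fact
  interpret C1: idempotent_component smul star bc_e1 bc_proj1 "norm_part1 nrm"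
  proof
    fix x assume "norm_part1 nrm x = 0"
    \<comment> \<open>The second coordinate of the norm of \<open>smul bc_e1 x\<close> is always 0,
      so now both coordinates vanish and definiteness of the full norm applies.\<close>
    then show "smul bc_e1 x = 0"
      by (simp add: N.norm_part_smul bc_proj_e flip: N.norm_parts_eq_0_iff)
  qed (simp_all add: bc_e1_idem bc_dagger3_e bc_proj_e bc_proj_of_complex N.norm_part_nonneg
      N.norm_part_smul N.norm_part_triangle)
  interpret C2: idempotent_component smul star bc_e2 bc_proj2 "norm_part2 nrm"
  proof
    fix x assume "norm_part2 nrm x = 0"
    then show "smul bc_e2 x = 0"
      by (simp add: N.norm_part_smul bc_proj_e flip: N.norm_parts_eq_0_iff)
  qed (simp_all add: bc_e2_idem bc_dagger3_e bc_proj_e bc_proj_of_complex N.norm_part_nonneg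
      N.norm_part_smul N.norm_part_triangle)
  show ?thesis
    unfolding C1.complex_Cstar_algebra_on_part_iff C2.complex_Cstar_algebra_on_part_iff
    using assms by (intro N.D_normed_bicomplex_Cstar_algebra_iff)
qed

end
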